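(* Let $T$ be a maximal partial transversal of deficit $d$ in a Latin square $L$ of order $n \geq 3$. (1) If $d=0$, then $T$ is contained in exactly $n^2-n$ distinct $(n+1)$-covers of $L$, none of which is minimal. (2) If $d=1$, then $T$ is contained in exactly $3(n-1)$ distinct $(n+1)$-covers of $L$, each of which is minimal. (3) If $d=2$, then $T$ is contained in exactly $8$ distinct $(n+1)$-covers of $L$. (4) If $d\ge 3$, then $T$ is not contained in any $(n+1)$-cover of $L$.
   Context: A Latin square of order $n$ is an $n\times n$ array on $n$ symbols in which each symbol occurs once in each row and each column; its set of entries is $E(L)=\{(i,j,L_{ij})\}$. A line is the set of all entries in a given row, in a given column, or with a given symbol. A cover is a subset of $E(L)$ meeting every line; a $c$-cover is a cover of size $c$; a cover $\mathscr{C}$ is minimal if $\mathscr{C}\setminus\{\mathbf{e}\}$ is not a cover for every $\mathbf{e}\in\mathscr{C}$. A partial transversal of deficit $d$ is an $(n-d)$-subset of $E(L)$ in which every line is represented at most once; it is maximal if adding any further entry of $E(L)$ destroys this property. *)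

theory Defs
  imports Main
begin

(* Rows and columns are indexed by 0, ..., n-1; the symbol set S is an arbitrary set with n elements.
   Values of L outside the n x n array are irrelevant. *)
definition latin_square :: "nat \<Rightarrow> 's set \<Rightarrow> (nat \<Rightarrow> nat \<Rightarrow> 's) \<Rightarrow> bool" where
  "latin_square n S L \<longleftrightarrow>
     finite S \<and> card S = n \<and>
     (\<forall>i<n. \<forall>j<n. L i j \<in> S) \<and>
     (\<forall>i<n. \<forall>s\<in>S. \<exists>!j. j < n \<and> L i j = s) \<and>
     (\<forall>j<n. \<forall>s\<in>S. \<exists>!i. i < n \<and> L i j = s)"

definition entries :: "nat \<Rightarrow> (nat \<Rightarrow> nat \<Rightarrow> 's) \<Rightarrow> (nat \<times> nat \<times> 's) set" where
  "entries n L = {(i, j, L i j) | i j. i < n \<and> j < n}"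

definition row_line :: "nat \<Rightarrow> (nat \<Rightarrow> nat \<Rightarrow> 's) \<Rightarrow> nat \<Rightarrow> (nat \<times> nat \<times> 's) set" where
  "row_line n L i = {e \<in> entries n L. fst e = i}"

definition col_line :: "nat \<Rightarrow> (nat \<Rightarrow> nat \<Rightarrow> 's) \<Rightarrow> nat \<Rightarrow> (nat \<times> nat \<times> 's) set" where
  "col_line n L j = {e \<in> entries n L. fst (snd e) = j}"

definition symbol_line :: "nat \<Rightarrow> (nat \<Rightarrow> nat \<Rightarrow> 's) \<Rightarrow> 's \<Rightarrow> (nat \<times> nat \<times> 's) set" where
  "symbol_line n L s = {e \<in> entries n L. snd (snd e) = s}"

definition latin_lines :: "nat \<Rightarrow> 's set \<Rightarrow> (nat \<Rightarrow> nat \<Rightarrow> 's) \<Rightarrow> (nat \<times> nat \<times> 's) set set" where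
  "latin_lines n S L =
     row_line n L ` {..<n} \<union> col_line n L ` {..<n} \<union> symbol_line n L ` S"

definition is_cover ::
  "nat \<Rightarrow> 's set \<Rightarrow> (nat \<Rightarrow> nat \<Rightarrow> 's) \<Rightarrow> (nat \<times> nat \<times> 's) set \<Rightarrow> bool" where
  "is_cover n S L C \<longleftrightarrow> C \<subseteq> entries n L \<and> (\<forall>l\<in>latin_lines n S L. C \<inter> l \<noteq> {})"

definition is_c_cover ::
  "nat \<Rightarrow> 's set \<Rightarrow> (nat \<Rightarrow> nat \<Rightarrow> 's) \<Rightarrow> nat \<Rightarrow> (nat \<times> nat \<times> 's) set \<Rightarrow> bool" where
  "is_c_cover n S L c C \<longleftrightarrow> is_cover n S L C \<and> card C = c"

definition minimal_cover ::
  "nat \<Rightarrow> 's set \<Rightarrow> (nat \<Rightarrow> nat \<Rightarrow> 's) \<Rightarrow> (nat \<times> nat \<times> 's) set \<Rightarrow> bool" where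
  "minimal_cover n S L C \<longleftrightarrow> is_cover n S L C \<and> (\<forall>e\<in>C. \<not> is_cover n S L (C - {e}))"

definition lines_at_most_once ::
  "nat \<Rightarrow> 's set \<Rightarrow> (nat \<Rightarrow> nat \<Rightarrow> 's) \<Rightarrow> (nat \<times> nat \<times> 's) set \<Rightarrow> bool" where
  "lines_at_most_once n S L T \<longleftrightarrow> (\<forall>l\<in>latin_lines n S L. card (T \<inter> l) \<le> 1)"

(* card T + d = n rather than card T = n - d, since subtraction on nat truncates. *)
definition partial_transversal ::
  "nat \<Rightarrow> 's set \<Rightarrow> (nat \<Rightarrow> nat \<Rightarrow> 's) \<Rightarrow> nat \<Rightarrow> (nat \<times> nat \<times> 's) set \<Rightarrow> bool" where
  "partial_transversal n S L d T \<longleftrightarrow>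
     T \<subseteq> entries n L \<and> card T + d = n \<and> lines_at_most_once n S L T"

definition maximal_partial_transversal ::
  "nat \<Rightarrow> 's set \<Rightarrow> (nat \<Rightarrow> nat \<Rightarrow> 's) \<Rightarrow> nat \<Rightarrow> (nat \<times> nat \<times> 's) set \<Rightarrow> bool" where
  "maximal_partial_transversal n S L d T \<longleftrightarrow>
     partial_transversal n S L d T \<and>
     (\<forall>e \<in> entries n L - T. \<not> lines_at_most_once n S L (insert e T))"

end

theory Submission
  imports Defs
begin

text \<open>
  A cover containing \<open>T\<close> is \<open>T \<union> U\<close>, where \<open>U\<close> consists of \<open>d + 1\<close> entries meeting the
  \<open>3 d\<close> lines (\<open>d\<close> rows, \<open>d\<close> columns, \<open>d\<close> symbols) missed by \<open>T\<close>. Maximality of \<open>T\<close> says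
  that no entry meets three of the missed lines, so \<open>3 d \<le> 2 (d + 1)\<close>, i.e. \<open>d \<le> 2\<close>. For \<open>d = 2\<close>
  equality holds, so \<open>U\<close> has exactly one entry of each kind row-column, row-symbol and
  column-symbol; the missed lines can be paired in \<open>2 \<cdot> 2 \<cdot> 2\<close> ways. For \<open>d = 1\<close> one entry
  of \<open>U\<close> is the one through two of the three missed lines and the other is any entry on the third.
  The rows, columns and symbols play the same role throughout: the hypotheses are invariant under
  rotating the three coordinates of an entry.
\<close>

section \<open>Latin squares as systems in which any two of three coordinates determine an
  entry\<close>

locale maximal_transversal =
  fixes E :: "'e set" and p :: "'e \<Rightarrow> 'x" and q :: "'e \<Rightarrow> 'y" and s :: "'e \<Rightarrow> 'z"
    and X :: "'x set" and Y :: "'y set" and Z :: "'z set" and n d :: nat and T :: "'e set"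
  assumes finite_X: "finite X" and finite_Y: "finite Y" and finite_Z: "finite Z"
    and card_X: "card X = n" and card_Y: "card Y = n" and card_Z: "card Z = n"
    and bij_pq: "bij_betw (\<lambda>e. (p e, q e)) E (X \<times> Y)"
    and bij_qs: "bij_betw (\<lambda>e. (q e, s e)) E (Y \<times> Z)"
    and bij_sp: "bij_betw (\<lambda>e. (s e, p e)) E (Z \<times> X)"
    and T_sub: "T \<subseteq> E" and card_T: "card T + d = n"
    and inj_p: "inj_on p T" and inj_q: "inj_on q T" and inj_s: "inj_on s T"
    and maximal: "e \<in> E \<Longrightarrow> p e \<in> p ` T \<or> q e \<in> q ` T \<or> s e \<in> s ` T"
begin

lemma rotate: "maximal_transversal E q s p Y Z X n d T"
  using finite_X finite_Y finite_Z card_X card_Y card_Z bij_pq bij_qs bij_sp T_sub card_T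
    inj_p inj_q inj_s maximal
  by unfold_locales blast+

lemma finite_E: "finite E"
  using bij_betw_finite[OF bij_pq] finite_X finite_Y by simp

lemma card_E: "card E = n ^ 2"
  using bij_betw_same_card[OF bij_pq] card_X card_Y
  by (simp add: card_cartesian_product power2_eq_square)

lemma finite_T: "finite T"
  using T_sub finite_E by (rule finite_subset)

lemma p_in: "e \<in> E \<Longrightarrow> p e \<in> X"
  using bij_betwE[OF bij_pq] by blast

lemma eq_if_pq: "e \<in> E \<Longrightarrow> f \<in> E \<Longrightarrow> p e = p f \<Longrightarrow> q e = q f \<Longrightarrow> e = f"
  using bij_betw_imp_inj_on[OF bij_pq] by (auto dest: inj_onD)

definition entry_at where
  "entry_at x y = inv_into E (\<lambda>e. (p e, q e)) (x, y)"

lemma entry_at: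
  assumes "x \<in> X" "y \<in> Y"
  shows "entry_at x y \<in> E" "p (entry_at x y) = x" "q (entry_at x y) = y"
proof -
  have "(x, y) \<in> (\<lambda>e. (p e, q e)) ` E"
    using assms bij_betw_imp_surj_on[OF bij_pq] by simp
  from inv_into_into[OF this] f_inv_into_f[OF this]
  show "entry_at x y \<in> E" "p (entry_at x y) = x" "q (entry_at x y) = y"
    by (auto simp: entry_at_def)
qed

definition P where "P = X - p ` T"

lemma card_P: "card P = d"
proof -
  have "p ` T \<subseteq> X" using T_sub p_in by blast
  then have "card P = n - card (p ` T)"
    unfolding P_def using finite_T card_X by (simp add: card_Diff_subset)
  then show ?thesis using card_T card_image[OF inj_p] by simp
qed

lemma finite_P: "finite P"
  unfolding P_def using finite_X by simp

lemma p_in_P_iff: "e \<in> E \<Longrightarrow> p e \<in> P \<longleftrightarrow> p e \<notin> p ` T"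
  unfolding P_def using p_in by blast

lemma notin_T: "p e \<in> P \<Longrightarrow> e \<notin> T"
  unfolding P_def by blast

text \<open>Within one fibre of \<open>p\<close> the second coordinate runs bijectively over
  \<open>Y\<close>. Rotated to \<open>s\<close>, this counts the candidates for the free entry when
  \<open>d = 1\<close>.\<close>

lemma card_fibre:
  assumes "x \<in> X"
  shows "card {e \<in> E. p e = x} = n"
proof -
  have "bij_betw (\<lambda>e. (p e, q e)) {e \<in> E. p e = x} ({x} \<times> Y)"
    unfolding bij_betw_def
  proof
    show "inj_on (\<lambda>e. (p e, q e)) {e \<in> E. p e = x}"
      using bij_betw_imp_inj_on[OF bij_pq] by (rule inj_on_subset) blast
    have "{x} \<times> Y \<subseteq> (\<lambda>e. (p e, q e)) ` E"
      using assms bij_betw_imp_surj_on[OF bij_pq] by auto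
    then show "(\<lambda>e. (p e, q e)) ` {e \<in> E. p e = x} = {x} \<times> Y"
      using bij_betwE[OF bij_pq] by auto
  qed
  from bij_betw_same_card[OF this] show ?thesis
    by (simp add: card_cartesian_product card_Y)
qed

end

text \<open>An interpretation inside a locale only transports the facts proved before it, so the locale
  is reopened whenever newer facts are needed for the rotated coordinates.\<close>

context maximal_transversal
begin

interpretation qsp: maximal_transversal E q s p Y Z X n d T
  by (rule rotate)

interpretation spq: maximal_transversal E s p q Z X Y n d T
  by (rule qsp.rotate)

abbreviation "Q \<equiv> qsp.P"
abbreviation "R \<equiv> spq.P"

text \<open>Such an entry could be added to \<open>T\<close>. Maximality enters the later arguments
  only in this form.\<close>

lemma no_triple: "e \<in> E \<Longrightarrow> p e \<in> P \<Longrightarrow> q e \<in> Q \<Longrightarrow> s e \<in> R \<Longrightarrow> False"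
  using maximal p_in_P_iff qsp.p_in_P_iff spq.p_in_P_iff by blast

section \<open>Reduction from covers containing \<open>T\<close> to small sets of added
  entries\<close>

definition cover where
  "cover C \<longleftrightarrow> C \<subseteq> E \<and> X \<subseteq> p ` C \<and> Y \<subseteq> q ` C \<and> Z \<subseteq> s ` C"

text \<open>These are the sets to be counted: what a cover of size \<open>n + 1\<close> adds to the
  \<open>n - d\<close> entries of \<open>T\<close>. Keeping \<open>U\<close> off \<open>T\<close>
  makes \<open>U\<close> recoverable from its union with \<open>T\<close>.\<close>

definition completion where
  "completion U \<longleftrightarrow> U \<subseteq> E - T \<and> card U = d + 1 \<and> P \<subseteq> p ` U \<and> Q \<subseteq> q ` U \<and> R \<subseteq> s ` U"

text \<open>\<open>T\<close> already meets every line outside \<open>P\<close>, \<open>Q\<close> and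
  \<open>R\<close>, and none of the lines inside them.\<close>

lemma cover_Un_iff:
  "cover (T \<union> U) \<longleftrightarrow> U \<subseteq> E \<and> P \<subseteq> p ` U \<and> Q \<subseteq> q ` U \<and> R \<subseteq> s ` U"
  unfolding cover_def P_def qsp.P_def spq.P_def using T_sub by blast

lemma covers_eq: "{C. cover C \<and> card C = n + 1 \<and> T \<subseteq> C} = (\<union>) T ` Collect completion"
proof (intro subset_antisym subsetI)
  fix C assume "C \<in> {C. cover C \<and> card C = n + 1 \<and> T \<subseteq> C}"
  then have C: "cover C" "card C = n + 1" "T \<subseteq> C" by auto
  then have eq: "C = T \<union> (C - T)" by blast
  have "card (C - T) = d + 1"
    using C finite_T card_T by (simp add: card_Diff_subset)
  moreover have "C - T \<subseteq> E - T" using C(1) unfolding cover_def by blast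
  ultimately have "completion (C - T)"
    unfolding completion_def using C(1) eq cover_Un_iff by metis
  then show "C \<in> (\<union>) T ` Collect completion" using eq by blast
next
  fix C assume "C \<in> (\<union>) T ` Collect completion"
  then obtain U where U: "completion U" "C = T \<union> U" by auto
  then have "finite U" "T \<inter> U = {}"
    unfolding completion_def using finite_subset[OF _ finite_E] by auto
  then have "card C = n + 1"
    using U finite_T card_T unfolding completion_def by (simp add: card_Un_disjoint)
  then show "C \<in> {C. cover C \<and> card C = n + 1 \<and> T \<subseteq> C}"
    using U cover_Un_iff[of U] unfolding completion_def by auto
qed

lemma card_covers:
  "card {C. cover C \<and> card C = n + 1 \<and> T \<subseteq> C} = card (Collect completion)"
  unfolding covers_eq
  by (rule card_image) (auto simp: inj_on_def completion_def)

text \<open>\<open>p\<close> maps the counted entries onto \<open>P\<close>, which has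
  \<open>d\<close> elements.\<close>

lemma card_hitting:
  assumes "U \<subseteq> E" "P \<subseteq> p ` U"
  shows "d \<le> card {u \<in> U. p u \<in> P}"
proof -
  have "P \<subseteq> p ` {u \<in> U. p u \<in> P}" using assms by blast
  then show ?thesis
    using surj_card_le[of "{u \<in> U. p u \<in> P}" P p] card_P finite_subset[OF assms(1) finite_E]
    by simp
qed

end

section \<open>The bound \<open>d <= 2\<close>\<close>

context maximal_transversal
begin

interpretation qsp: maximal_transversal E q s p Y Z X n d T
  by (rule rotate)

interpretation spq: maximal_transversal E s p q Z X Y n d T
  by (rule qsp.rotate)

lemma deficit_le_2:
  assumes "completion U"
  shows "d \<le> 2"
proof -
  let ?A = "{u \<in> U. p u \<in> P}" and ?B = "{u \<in> U. q u \<in> Q}" and ?D = "{u \<in> U. s u \<in> R}"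
  have U: "U \<subseteq> E" "card U = d + 1" "P \<subseteq> p ` U" "Q \<subseteq> q ` U" "R \<subseteq> s ` U"
    using assms unfolding completion_def by auto
  then have fin: "finite U" using finite_E finite_subset by blast
  have empty: "?A \<inter> ?B \<inter> ?D = {}" using no_triple U(1) by blast
  \<comment> \<open>The sizes of \<open>?A\<close>, \<open>?B\<close>, \<open>?D\<close> add up to
    the sizes of two subsets of \<open>U\<close>: the union of \<open>?A\<close> and
    \<open>?B\<close>, and the union of their intersection with \<open>?D\<close>, which is disjoint
    by \<open>empty\<close>. Hence \<open>3 * d <= 2 * (d + 1)\<close>.\<close>
  have "card ?A + card ?B = card (?A \<union> ?B) + card (?A \<inter> ?B)"
    using fin by (intro card_Un_Int) auto
  moreover have "card (?A \<union> ?B) \<le> card U"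
    using fin by (intro card_mono) auto
  moreover have "card (?A \<inter> ?B) + card ?D = card (?A \<inter> ?B \<union> ?D)"
    using fin empty by (subst card_Un_disjoint) auto
  moreover have "card (?A \<inter> ?B \<union> ?D) \<le> card U"
    using fin by (intro card_mono) auto
  moreover have "d \<le> card ?A" "d \<le> card ?B" "d \<le> card ?D"
    using card_hitting qsp.card_hitting spq.card_hitting U by auto
  ultimately show ?thesis using U(2) by simp
qed

section \<open>Deficit 0: one arbitrary added entry\<close>

lemma completion_deficit_0_iff:
  assumes "d = 0"
  shows "completion U \<longleftrightarrow> (\<exists>e \<in> E - T. U = {e})"
proof -
  have "P = {}" "Q = {}" "R = {}"
    using assms card_P qsp.card_P spq.card_P finite_P qsp.finite_P spq.finite_P by auto
  then show ?thesis
    unfolding completion_def using assms by (auto simp: card_1_singleton_iff)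
qed

lemma card_completion_deficit_0:
  assumes "d = 0"
  shows "card (Collect completion) = n ^ 2 - n"
proof -
  have "Collect completion = (\<lambda>e. {e}) ` (E - T)"
    using completion_deficit_0_iff[OF assms] by auto
  then have "card (Collect completion) = card (E - T)"
    by (simp add: card_image)
  then show ?thesis
    using T_sub finite_T card_E card_T assms by (simp add: card_Diff_subset)
qed

lemma deficit_0_not_minimal:
  assumes "d = 0" "completion U"
  shows "\<exists>e \<in> T \<union> U. cover (T \<union> U - {e})"
proof -
  obtain e where e: "e \<in> E - T" "U = {e}"
    using assms completion_deficit_0_iff by blast
  have "P = {}" "Q = {}" "R = {}"
    using assms card_P qsp.card_P spq.card_P finite_P qsp.finite_P spq.finite_P by auto
  then have "cover T" using cover_Un_iff[of "{}"] by simp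
  moreover have "T \<union> U - {e} = T" using e by auto
  ultimately show ?thesis using e by auto
qed

end

section \<open>Deficit 1: three families of pairs\<close>

context maximal_transversal
begin

interpretation qsp: maximal_transversal E q s p Y Z X n d T
  by (rule rotate)

interpretation spq: maximal_transversal E s p q Z X Y n d T
  by (rule qsp.rotate)

text \<open>By injectivity on \<open>T\<close>, the row and column of a removed \<open>e\<close> can
  only be met by \<open>c\<close> or \<open>f\<close>. The entry \<open>c\<close> lies in a missed
  row and column, so \<open>f\<close> must meet both, which forces \<open>f = e\<close>.\<close>

lemma not_cover_remove:
  assumes "x \<in> P" "y \<in> Q" "c \<in> E" "p c = x" "q c = y" "f \<in> E - T" "e \<in> T"
  shows "\<not> cover (T \<union> {c, f} - {e})"
proof
  assume cov: "cover (T \<union> {c, f} - {e})"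
  have e: "e \<in> E" using T_sub assms by blast
  have "p e \<in> p ` (T \<union> {c, f} - {e})" "q e \<in> q ` (T \<union> {c, f} - {e})"
    using cov e p_in qsp.p_in unfolding cover_def by blast+
  moreover have "p e \<noteq> p c" "q e \<noteq> q c"
    using assms imageI[OF assms(7), of p] imageI[OF assms(7), of q] unfolding P_def qsp.P_def
    by force+
  ultimately have "p f = p e" "q f = q e"
    using inj_onD[OF inj_p] inj_onD[OF inj_q] assms(7) by auto
  then show False using eq_if_pq e assms by blast
qed

text \<open>For \<open>d = 1\<close>, \<open>c\<close> takes care of two missed lines and
  \<open>f\<close> of the third. If \<open>f\<close> also lies on the missed line of
  \<open>Q\<close>, the pair stays in this family and is excluded from the one in which
  \<open>f\<close> would play the role of \<open>c\<close>.\<close>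

definition pairs where
  "pairs = {{c, f} | c f. c \<in> E \<and> f \<in> E \<and> p c \<in> P \<and> q c \<in> Q \<and> s f \<in> R \<and> p f \<notin> P}"

text \<open>The condition \<open>p f \<notin> P\<close> makes the three families obtained by rotation disjoint.\<close>

lemma card_pairs:
  assumes "d = 1"
  shows "card pairs = n - 1"
proof -
  obtain x y z where xyz: "P = {x}" "Q = {y}" "R = {z}"
    using card_P qsp.card_P spq.card_P assms by (metis card_1_singletonE)
  then have in_XYZ: "x \<in> X" "y \<in> Y" "z \<in> Z"
    unfolding P_def qsp.P_def spq.P_def by auto
  obtain c where c: "c \<in> E" "p c = x" "q c = y" using entry_at in_XYZ by blast
  \<comment> \<open>\<open>b\<close> is the one entry on the missed symbol that the condition on
    \<open>p f\<close> excludes, whence \<open>n - 1\<close> instead of \<open>n\<close>.\<close>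
  obtain b where b: "b \<in> E" "s b = z" "p b = x" using spq.entry_at in_XYZ by blast
  let ?F = "{f \<in> E. s f = z} - {b}"
  have F: "?F = {f \<in> E. s f = z \<and> p f \<noteq> x}"
    using b spq.eq_if_pq by auto
  have "pairs = (\<lambda>f. {c, f}) ` ?F"
    unfolding pairs_def F using xyz c eq_if_pq by fastforce
  \<comment> \<open>The pair determines \<open>f\<close>, since \<open>c\<close> lies in the missed
    row and \<open>f\<close> does not.\<close>
  moreover have "inj_on (\<lambda>f. {c, f}) ?F"
    using c(2) unfolding F by (auto simp: inj_on_def doubleton_eq_iff)
  ultimately have "card pairs = card ?F" by (simp add: card_image)
  then show ?thesis using b spq.card_fibre[OF in_XYZ(3)] finite_E by simp
qed

end

context maximal_transversal
begin

interpretation qsp: maximal_transversal E q s p Y Z X n d T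
  by (rule rotate)

interpretation spq: maximal_transversal E s p q Z X Y n d T
  by (rule qsp.rotate)

text \<open>Two entries must meet three missed lines and neither meets all three, so one of them
  meets exactly two and the other meets the remaining one.\<close>

lemma completion_deficit_1:
  assumes "d = 1"
  shows "Collect completion = pairs \<union> qsp.pairs \<union> spq.pairs"
proof -
  obtain x y z where xyz: "P = {x}" "Q = {y}" "R = {z}"
    using card_P qsp.card_P spq.card_P assms by (metis card_1_singletonE)
  have out: "e \<notin> T" if "p e = x \<or> q e = y \<or> s e = z" for e
    using that xyz unfolding P_def qsp.P_def spq.P_def by blast
  have no: "e \<in> E \<Longrightarrow> p e = x \<Longrightarrow> q e = y \<Longrightarrow> s e = z \<Longrightarrow> False" for e
    using no_triple xyz by auto
  show ?thesis
  proof (intro subset_antisym subsetI)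
    fix U assume "U \<in> Collect completion"
    then have U: "U \<subseteq> E" "card U = 2" "x \<in> p ` U" "y \<in> q ` U" "z \<in> s ` U"
      unfolding completion_def xyz using assms by auto
    then obtain e f where ef: "U = {e, f}" by (meson card_2_iff)
    \<comment> \<open>\<open>u\<close> is an entry on two missed lines and \<open>v\<close> meets
      the third. If both entries lie on two missed lines, the inequality admits only one of the two
      orders.\<close>
    have mem: "{u, v} \<in> pairs \<union> qsp.pairs \<union> spq.pairs"
      if "u \<in> E" "v \<in> E" "p u = x \<and> q u = y \<and> s v = z \<and> p v \<noteq> x \<or>
          q u = y \<and> s u = z \<and> p v = x \<and> q v \<noteq> y \<or>
          s u = z \<and> p u = x \<and> q v = y \<and> s v \<noteq> z" for u v
      using that unfolding pairs_def qsp.pairs_def spq.pairs_def xyz by blast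
    have swap: "{e, f} = {f, e}" by blast
    have "e \<in> E" "f \<in> E" "p e = x \<or> p f = x" "q e = y \<or> q f = y" "s e = z \<or> s f = z"
      using U ef by auto
    then show "U \<in> pairs \<union> qsp.pairs \<union> spq.pairs"
      unfolding ef using mem[of e f] mem[of f e, folded swap] no[of e] no[of f] by argo
  next
    fix U assume "U \<in> pairs \<union> qsp.pairs \<union> spq.pairs"
    then show "U \<in> Collect completion"
      unfolding pairs_def qsp.pairs_def spq.pairs_def completion_def xyz
      using assms out no by (fastforce simp: card_insert_if)
  qed
qed

text \<open>If a pair lay in both families, its \<open>c\<close> would either be the
  \<open>c\<close> of the other family, hence on three missed lines, or be the \<open>f\<close> of
  the other family, which must avoid \<open>Q\<close>.\<close>

lemma pairs_rotate_disjoint: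
  assumes "d = 1"
  shows "pairs \<inter> qsp.pairs = {}"
proof -
  obtain x y z where xyz: "P = {x}" "Q = {y}" "R = {z}"
    using card_P qsp.card_P spq.card_P assms by (metis card_1_singletonE)
  have no: "e \<in> E \<Longrightarrow> p e = x \<Longrightarrow> q e = y \<Longrightarrow> s e = z \<Longrightarrow> False" for e
    using no_triple xyz by auto
  show ?thesis
    unfolding pairs_def qsp.pairs_def xyz using no by (auto simp: doubleton_eq_iff)
qed

lemma cover_rotate: "qsp.cover C \<longleftrightarrow> cover C"
  unfolding cover_def qsp.cover_def by blast

end

context maximal_transversal
begin

interpretation qsp: maximal_transversal E q s p Y Z X n d T
  by (rule rotate)

interpretation spq: maximal_transversal E s p q Z X Y n d T
  by (rule qsp.rotate)

lemma card_completion_deficit_1: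
  assumes "d = 1"
  shows "card (Collect completion) = 3 * (n - 1)"
proof -
  have fin: "finite (Collect completion)"
    by (rule finite_subset[of _ "Pow E"]) (auto simp: completion_def finite_E)
  then have "finite pairs" "finite qsp.pairs" "finite spq.pairs"
    unfolding completion_deficit_1[OF assms] by auto
  moreover have "pairs \<inter> qsp.pairs = {}" "qsp.pairs \<inter> spq.pairs = {}" "spq.pairs \<inter> pairs = {}"
    using pairs_rotate_disjoint qsp.pairs_rotate_disjoint spq.pairs_rotate_disjoint assms by auto
  ultimately have "card (pairs \<union> qsp.pairs \<union> spq.pairs)
      = card pairs + card qsp.pairs + card spq.pairs"
    by (subst card_Un_disjoint; (subst card_Un_disjoint)?) auto
  then show ?thesis
    using completion_deficit_1 card_pairs qsp.card_pairs spq.card_pairs assms by simp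
qed

lemma not_cover_pairs:
  assumes "U \<in> pairs" "U \<subseteq> E - T" "e \<in> T"
  shows "\<not> cover (T \<union> U - {e})"
proof -
  obtain c f where "c \<in> E" "f \<in> E" "p c \<in> P" "q c \<in> Q" "U = {c, f}"
    using assms(1) unfolding pairs_def by blast
  then show ?thesis using not_cover_remove assms by blast
qed

end

context maximal_transversal
begin

interpretation qsp: maximal_transversal E q s p Y Z X n d T
  by (rule rotate)

interpretation spq: maximal_transversal E s p q Z X Y n d T
  by (rule qsp.rotate)

text \<open>Removing an entry of \<open>T\<close> is excluded in each family by a rotation of
  \<open>not_cover_pairs\<close>. Removing one of \<open>U\<close> leaves a single added entry,
  which would have to meet all three missed lines.\<close>

lemma deficit_1_minimal:
  assumes "d = 1" "completion U" "e \<in> T \<union> U"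
  shows "\<not> cover (T \<union> U - {e})"
proof (cases "e \<in> T")
  case True
  moreover have "U \<in> pairs \<union> qsp.pairs \<union> spq.pairs" "U \<subseteq> E - T"
    using completion_deficit_1[OF assms(1)] assms(2) by (auto simp: completion_def)
  ultimately show ?thesis
    using not_cover_pairs qsp.not_cover_pairs spq.not_cover_pairs
      cover_rotate qsp.cover_rotate by blast
next
  case False
  then have e: "e \<in> U" using assms(3) by blast
  have U: "U \<subseteq> E - T" "card U = 2"
    using assms unfolding completion_def by auto
  then have "card (U - {e}) = 1" using e by simp
  then obtain f where f: "U - {e} = {f}" by (meson card_1_singletonE)
  then have "f \<in> E" using U by blast
  obtain x y z where xyz: "P = {x}" "Q = {y}" "R = {z}"
    using card_P qsp.card_P spq.card_P assms(1) by (metis card_1_singletonE)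
  have "T \<union> U - {e} = T \<union> {f}" using f False by blast
  then show ?thesis
    using cover_Un_iff[of "{f}"] no_triple[OF \<open>f \<in> E\<close>] xyz by auto
qed

section \<open>Deficit 2: eight triples\<close>

text \<open>The double count is now tight: each of \<open>?A\<close>, \<open>?B\<close>,
  \<open>?D\<close> omits exactly one of the three entries. These are \<open>a\<close>,
  \<open>b\<close>, \<open>c\<close> respectively, so each entry misses one kind of line and meets
  the other two.\<close>

lemma completion_deficit_2:
  assumes "d = 2" "completion U"
  obtains a b c where "U = {a, b, c}" "a \<in> E" "b \<in> E" "c \<in> E"
    "P = {p b, p c}" "Q = {q a, q c}" "R = {s a, s b}"
proof -
  let ?A = "{u \<in> U. p u \<in> P}" and ?B = "{u \<in> U. q u \<in> Q}" and ?D = "{u \<in> U. s u \<in> R}"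
  have U: "U \<subseteq> E" "card U = 3" "P \<subseteq> p ` U" "Q \<subseteq> q ` U" "R \<subseteq> s ` U"
    using assms unfolding completion_def by auto
  then have fin: "finite U" using finite_E finite_subset by blast
  have ge: "2 \<le> card ?A" "2 \<le> card ?B" "2 \<le> card ?D"
    using card_hitting qsp.card_hitting spq.card_hitting U assms(1) by auto
  have empty: "?A \<inter> ?B \<inter> ?D = {}" using no_triple U(1) by blast
  \<comment> \<open>If \<open>W\<close> were all of \<open>U\<close>, then \<open>W1\<close> and
    \<open>W2\<close> would be disjoint and have at least four elements inside a set of
    three.\<close>
  have compl: "\<exists>v. v \<in> U \<and> U - W = {v}"
    if "2 \<le> card W" "W \<subseteq> U" "2 \<le> card W1" "W1 \<subseteq> U" "2 \<le> card W2" "W2 \<subseteq> U"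
      "W \<inter> W1 \<inter> W2 = {}" for W W1 W2
  proof -
    have "W \<noteq> U"
    proof
      assume "W = U"
      then have "W1 \<inter> W2 = {}" using that by blast
      then have "card (W1 \<union> W2) = card W1 + card W2"
        using that fin by (meson card_Un_disjoint finite_subset)
      moreover have "card (W1 \<union> W2) \<le> card U" using that fin by (intro card_mono) auto
      ultimately show False using that U(2) by simp
    qed
    then have "card W < card U" using that fin by (meson psubsetI psubset_card_mono)
    then have "card (U - W) = 1"
      using that U(2) fin by (simp add: card_Diff_subset finite_subset)
    then show ?thesis by (metis Diff_subset card_1_singletonE insert_subset)
  qed
  obtain a where a: "a \<in> U" "U - ?A = {a}"
    using compl[of ?A ?B ?D] ge empty by blast
  obtain b where b: "b \<in> U" "U - ?B = {b}"
    using compl[of ?B ?A ?D] ge empty by blast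
  obtain c where c: "c \<in> U" "U - ?D = {c}"
    using compl[of ?D ?A ?B] ge empty by blast
  \<comment> \<open>An entry different from all three would lie in \<open>?A\<close>,
    \<open>?B\<close> and \<open>?D\<close> at once.\<close>
  have eq: "U = {a, b, c}"
  proof
    show "U \<subseteq> {a, b, c}" using a b c empty by blast
  qed (use a b c in blast)
  have "card {a, b, c} = 3" using U(2) eq by simp
  then have ne: "a \<noteq> b" "b \<noteq> c" "a \<noteq> c" by (auto simp: card_insert_if split: if_splits)
  have "?A = U - {a}" "?B = U - {b}" "?D = U - {c}" using a b c by blast+
  then have ABD: "?A = {b, c}" "?B = {a, c}" "?D = {a, b}" using eq ne by auto
  have "p ` ?A = P" "q ` ?B = Q" "s ` ?D = R" using U(3-5) by blast+
  note sets = this[unfolded ABD image_insert image_empty, symmetric]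
  show ?thesis
    by (rule that[OF eq _ _ _ sets]) (use a b c U(1) in blast)+
qed

text \<open>A completion is determined by the row and column of its row-column entry and the symbol
  of its row-symbol entry; all choices in \<open>P\<close>, \<open>Q\<close>, \<open>R\<close>
  occur.\<close>

lemma card_completion_deficit_2:
  assumes "d = 2"
  shows "card (Collect completion) = 8"
proof -
  obtain x1 x2 where x: "P = {x1, x2}" "x1 \<noteq> x2"
    using card_P assms by (metis card_2_iff)
  obtain y1 y2 where y: "Q = {y1, y2}" "y1 \<noteq> y2"
    using qsp.card_P assms by (metis card_2_iff)
  obtain z1 z2 where z: "R = {z1, z2}" "z1 \<noteq> z2"
    using spq.card_P assms by (metis card_2_iff)
  \<comment> \<open>On \<open>P\<close>, \<open>Q\<close>, \<open>R\<close> these maps exchange the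
    two missed lines of each kind.\<close>
  define x' where "x' x = (if x = x1 then x2 else x1)" for x
  define y' where "y' y = (if y = y1 then y2 else y1)" for y
  define z' where "z' z = (if z = z1 then z2 else z1)" for z
  have x'_eq: "v = x' u" if "P = {v, u}" for u v
    using that x by (auto simp: x'_def doubleton_eq_iff)
  have y'_eq: "v = y' u" if "Q = {v, u}" for u v
    using that y by (auto simp: y'_def doubleton_eq_iff)
  have z'_eq: "v = z' u" if "R = {v, u}" for u v
    using that z by (auto simp: z'_def doubleton_eq_iff)
  have x'_in: "P = {u, x' u}" if "u \<in> P" for u
    using that x by (auto simp: x'_def)
  have y'_in: "Q = {u, y' u}" if "u \<in> Q" for u
    using that y by (auto simp: y'_def)
  have z'_in: "R = {u, z' u}" if "u \<in> R" for u
    using that z by (auto simp: z'_def)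
  have subs: "P \<subseteq> X" "Q \<subseteq> Y" "R \<subseteq> Z"
    unfolding P_def qsp.P_def spq.P_def by auto
  define pq where "pq = entry_at"
  define qs where "qs = qsp.entry_at"
  define sp where "sp = spq.entry_at"
  have pq: "pq u v \<in> E" "p (pq u v) = u" "q (pq u v) = v" if "u \<in> P" "v \<in> Q" for u v
    using that subs unfolding pq_def by (blast intro: entry_at)+
  have qs: "qs u v \<in> E" "q (qs u v) = u" "s (qs u v) = v" if "u \<in> Q" "v \<in> R" for u v
    using that subs unfolding qs_def by (blast intro: qsp.entry_at)+
  have sp: "sp u v \<in> E" "s (sp u v) = u" "p (sp u v) = v" if "u \<in> R" "v \<in> P" for u v
    using that subs unfolding sp_def by (blast intro: spq.entry_at)+
  \<comment> \<open>The row-column entry uses \<open>u\<close> and \<open>v\<close>, the row-symbol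
    entry the other row and \<open>w\<close>; the column-symbol entry takes the column and symbol
    left over.\<close>
  define G where "G = (\<lambda>(u, v, w). {pq u v, sp w (x' u), qs (y' v) (z' w)})"
  \<comment> \<open>The last four facts let \<open>u\<close> and \<open>v\<close> be read off from
    the row-column entry and \<open>w\<close> from the row-symbol entry, which gives
    injectivity.\<close>
  have G: "completion (G (u, v, w))"
      "\<And>e. e \<in> G (u, v, w) \<Longrightarrow> p e \<in> P \<Longrightarrow> q e \<in> Q \<Longrightarrow> p e = u \<and> q e = v"
      "\<And>e. e \<in> G (u, v, w) \<Longrightarrow> s e \<in> R \<Longrightarrow> p e \<in> P \<Longrightarrow> s e = w"
      "\<exists>e \<in> G (u, v, w). p e = u \<and> q e = v" "\<exists>e \<in> G (u, v, w). s e = w \<and> p e = x' u"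
    if uvw: "u \<in> P" "v \<in> Q" "w \<in> R" for u v w
  proof -
    have in': "x' u \<in> P" "y' v \<in> Q" "z' w \<in> R"
      using x'_in y'_in z'_in uvw by blast+
    let ?c = "pq u v" and ?b = "sp w (x' u)" and ?a = "qs (y' v) (z' w)"
    note c = pq[OF uvw(1,2)] and b = sp[OF uvw(3) in'(1)] and a = qs[OF in'(2,3)]
    \<comment> \<open>Each entry meets missed lines of two kinds, hence none of the third kind; this
      separates the three entries.\<close>
    have nR: "s ?c \<notin> R" using no_triple[OF c(1)] c uvw by auto
    have nQ: "q ?b \<notin> Q" using no_triple[OF b(1)] b uvw in' by auto
    have nP: "p ?a \<notin> P" using no_triple[OF a(1)] a in' by auto
    have "?c \<noteq> ?b" "?c \<noteq> ?a" "?b \<noteq> ?a" using nR nQ nP c b a uvw in' by metis+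
    then have "card (G (u, v, w)) = 3" by (simp add: G_def)
    moreover have "?c \<notin> T" "?b \<notin> T" "?a \<notin> T"
      using notin_T[of ?c] notin_T[of ?b] qsp.notin_T[of ?a] a b c uvw in' by auto
    moreover have "P \<subseteq> p ` G (u, v, w)" "Q \<subseteq> q ` G (u, v, w)" "R \<subseteq> s ` G (u, v, w)"
      using x'_in[OF uvw(1)] y'_in[OF uvw(2)] z'_in[OF uvw(3)] a b c by (auto simp: G_def)
    ultimately show "completion (G (u, v, w))"
      unfolding completion_def using a b c assms by (auto simp: G_def)
    show "p e = u \<and> q e = v" if "e \<in> G (u, v, w)" "p e \<in> P" "q e \<in> Q" for e
      using that c nP nQ by (auto simp: G_def)
    show "s e = w" if "e \<in> G (u, v, w)" "s e \<in> R" "p e \<in> P" for e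
      using that b nP nR by (auto simp: G_def)
    show "\<exists>e \<in> G (u, v, w). p e = u \<and> q e = v" "\<exists>e \<in> G (u, v, w). s e = w \<and> p e = x' u"
      using b c by (auto simp: G_def)
  qed
  have "inj_on G (P \<times> Q \<times> R)"
  proof (rule inj_onI)
    fix t t' assume t: "t \<in> P \<times> Q \<times> R" "t' \<in> P \<times> Q \<times> R" "G t = G t'"
    obtain u v w u' v' w' where tt: "t = (u, v, w)" "t' = (u', v', w')"
      by (metis prod.exhaust)
    then have mem: "u \<in> P" "v \<in> Q" "w \<in> R" "u' \<in> P" "v' \<in> Q" "w' \<in> R" using t by auto
    obtain e where "e \<in> G t'" "p e = u" "q e = v"
      using G(4)[OF mem(1-3)] t tt by auto
    then have "u = u'" "v = v'" using G(2)[OF mem(4-6), of e] mem tt by auto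
    moreover obtain f where "f \<in> G t'" "s f = w" "p f = x' u"
      using G(5)[OF mem(1-3)] t tt by auto
    then have "w = w'" using G(3)[OF mem(4-6), of f] mem tt x'_in by blast
    ultimately show "t = t'" using tt by simp
  qed
  moreover have "Collect completion = G ` (P \<times> Q \<times> R)"
  proof (intro subset_antisym subsetI)
    fix U assume "U \<in> Collect completion"
    then obtain a b c where abc: "U = {a, b, c}" "a \<in> E" "b \<in> E" "c \<in> E"
        "P = {p b, p c}" "Q = {q a, q c}" "R = {s a, s b}"
      using completion_deficit_2[OF assms] by blast
    have mem: "p c \<in> P" "q c \<in> Q" "s b \<in> R" "p b \<in> P" "q a \<in> Q" "s a \<in> R"
      using abc(5-7) by auto
    have "x' (p c) = p b" "y' (q c) = q a" "z' (s b) = s a"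
      by (rule x'_eq[OF abc(5), symmetric] y'_eq[OF abc(6), symmetric] z'_eq[OF abc(7), symmetric])+
    moreover have "pq (p c) (q c) = c" using eq_if_pq[OF pq(1) abc(4)] pq(2,3) mem by simp
    moreover have "sp (s b) (p b) = b" using spq.eq_if_pq[OF sp(1) abc(3)] sp(2,3) mem by simp
    moreover have "qs (q a) (s a) = a" using qsp.eq_if_pq[OF qs(1) abc(2)] qs(2,3) mem by simp
    ultimately have "G (p c, q c, s b) = U" using abc(1) by (auto simp: G_def)
    then show "U \<in> G ` (P \<times> Q \<times> R)" using mem by blast
  qed (use G(1) in auto)
  ultimately have "card (Collect completion) = card (P \<times> Q \<times> R)"
    by (simp add: card_image)
  also have "\<dots> = 8"
    using card_P qsp.card_P spq.card_P assms by (simp add: card_cartesian_product)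
  finally show ?thesis .
qed

end

section \<open>Latin squares and their lines as an instance of the locale\<close>

lemma entries_eq_image: "entries n L = (\<lambda>(i, j). (i, j, L i j)) ` ({..<n} \<times> {..<n})"
  unfolding entries_def by auto

lemma ball_latin_lines:
  "(\<forall>l\<in>latin_lines n S L. \<Phi> l) \<longleftrightarrow>
     (\<forall>i\<in>{..<n}. \<Phi> {e \<in> entries n L. fst e = i}) \<and>
     (\<forall>j\<in>{..<n}. \<Phi> {e \<in> entries n L. fst (snd e) = j}) \<and>
     (\<forall>z\<in>S. \<Phi> {e \<in> entries n L. snd (snd e) = z})"
  unfolding latin_lines_def row_line_def col_line_def symbol_line_def by auto

text \<open>Finiteness matters: an infinite fibre would have \<open>card\<close> equal to 0 and pass
  the bound.\<close>

lemma card_fibres_le_1_iff_inj_on: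
  assumes "finite E" "T \<subseteq> E" "f ` E \<subseteq> X"
  shows "(\<forall>x\<in>X. card (T \<inter> {e \<in> E. f e = x}) \<le> 1) \<longleftrightarrow> inj_on f T"
proof -
  have "finite (T \<inter> {e \<in> E. f e = x})" for x using assms by simp
  then have "card (T \<inter> {e \<in> E. f e = x}) \<le> 1 \<longleftrightarrow>
      (\<forall>e\<in>T. \<forall>e'\<in>T. f e = x \<longrightarrow> f e' = x \<longrightarrow> e = e')" for x
    using assms(2) unfolding One_nat_def card_le_Suc0_iff_eq[OF \<open>finite (T \<inter> {e \<in> E. f e = x})\<close>]
    by blast
  then show ?thesis
    using assms(2,3) unfolding inj_on_def by (simp add: image_subset_iff) blast
qed

lemma meets_fibres_iff_image:
  assumes "C \<subseteq> E"
  shows "(\<forall>x\<in>X. C \<inter> {e \<in> E. f e = x} \<noteq> {}) \<longleftrightarrow> X \<subseteq> f ` C"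
proof -
  have "C \<inter> {e \<in> E. f e = x} \<noteq> {} \<longleftrightarrow> x \<in> f ` C" for x
    using assms by auto
  then show ?thesis by (simp add: subset_eq)
qed

lemma lines_at_most_once_iff:
  assumes "latin_square n S L" "T \<subseteq> entries n L"
  shows "lines_at_most_once n S L T \<longleftrightarrow>
    inj_on fst T \<and> inj_on (\<lambda>e. fst (snd e)) T \<and> inj_on (\<lambda>e. snd (snd e)) T"
proof -
  have fin: "finite (entries n L)" unfolding entries_eq_image by simp
  have img: "fst ` entries n L \<subseteq> {..<n}" "(\<lambda>e. fst (snd e)) ` entries n L \<subseteq> {..<n}"
    "(\<lambda>e. snd (snd e)) ` entries n L \<subseteq> S"
    using assms(1) unfolding entries_def latin_square_def by auto
  show ?thesis
    unfolding lines_at_most_once_def ball_latin_lines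
    using card_fibres_le_1_iff_inj_on[OF fin assms(2) img(1)]
      card_fibres_le_1_iff_inj_on[OF fin assms(2) img(2)]
      card_fibres_le_1_iff_inj_on[OF fin assms(2) img(3)]
    by simp
qed

text \<open>Rows and columns index the entries because \<open>L\<close> is a function. For the
  bijections involving symbols, the existence part of the Latin property gives surjectivity and the
  uniqueness part injectivity.\<close>

lemma maximal_transversal_of_latin_square:
  assumes L: "latin_square n S L" and T: "maximal_partial_transversal n S L d T"
  shows "maximal_transversal (entries n L) fst (\<lambda>e. fst (snd e)) (\<lambda>e. snd (snd e))
    {..<n} {..<n} S n d T"
proof
  let ?p = "fst :: nat \<times> nat \<times> 's \<Rightarrow> nat" and ?q = "\<lambda>e :: nat \<times> nat \<times> 's. fst (snd e)"
    and ?s = "\<lambda>e :: nat \<times> nat \<times> 's. snd (snd e)"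
  have sym: "L i j \<in> S" if "i < n" "j < n" for i j
    using L that unfolding latin_square_def by simp
  have row: "\<exists>!j. j < n \<and> L i j = z" if "i < n" "z \<in> S" for i z
    using L that unfolding latin_square_def by simp
  have col: "\<exists>!i. i < n \<and> L i j = z" if "j < n" "z \<in> S" for j z
    using L that unfolding latin_square_def by simp
  have col_inj: "i = i'" if "i < n" "i' < n" "j < n" "L i j = L i' j" for i i' j
    using col[OF that(3) sym[OF that(1,3)]] that by metis
  have row_inj: "j = j'" if "i < n" "j < n" "j' < n" "L i j = L i j'" for i j j'
    using row[OF that(1) sym[OF that(1,2)]] that by metis
  show "finite S" "card S = n" using L unfolding latin_square_def by auto
  show "bij_betw (\<lambda>e. (?p e, ?q e)) (entries n L) ({..<n} \<times> {..<n})"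
    unfolding bij_betw_def inj_on_def entries_def by force
  show "bij_betw (\<lambda>e. (?q e, ?s e)) (entries n L) ({..<n} \<times> S)"
    unfolding bij_betw_def
  proof
    show "inj_on (\<lambda>e. (?q e, ?s e)) (entries n L)"
      unfolding inj_on_def entries_def using col_inj by auto
    show "(\<lambda>e. (?q e, ?s e)) ` entries n L = {..<n} \<times> S"
    proof (intro subset_antisym subsetI)
      fix t assume "t \<in> {..<n} \<times> S"
      then obtain j z where t: "t = (j, z)" "j < n" "z \<in> S" by auto
      then obtain i where "i < n" "L i j = z" using col by blast
      then show "t \<in> (\<lambda>e. (?q e, ?s e)) ` entries n L"
        using t unfolding entries_def by force
    qed (auto simp: entries_def sym)
  qed
  show "bij_betw (\<lambda>e. (?s e, ?p e)) (entries n L) (S \<times> {..<n})"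
    unfolding bij_betw_def
  proof
    show "inj_on (\<lambda>e. (?s e, ?p e)) (entries n L)"
      unfolding inj_on_def entries_def using row_inj by auto
    show "(\<lambda>e. (?s e, ?p e)) ` entries n L = S \<times> {..<n}"
    proof (intro subset_antisym subsetI)
      fix t assume "t \<in> S \<times> {..<n}"
      then obtain i z where t: "t = (z, i)" "i < n" "z \<in> S" by auto
      then obtain j where "j < n" "L i j = z" using row by blast
      then show "t \<in> (\<lambda>e. (?s e, ?p e)) ` entries n L"
        using t unfolding entries_def by force
    qed (auto simp: entries_def sym)
  qed
  show sub: "T \<subseteq> entries n L" and "card T + d = n"
    using T unfolding maximal_partial_transversal_def partial_transversal_def by auto
  have "lines_at_most_once n S L T"
    using T unfolding maximal_partial_transversal_def partial_transversal_def by auto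
  then show inj: "inj_on ?p T" "inj_on ?q T" "inj_on ?s T"
    using lines_at_most_once_iff[OF L sub] by auto
  show "?p e \<in> ?p ` T \<or> ?q e \<in> ?q ` T \<or> ?s e \<in> ?s ` T" if e: "e \<in> entries n L" for e
  proof (cases "e \<in> T")
    case False
    then have "\<not> lines_at_most_once n S L (insert e T)"
      using T e unfolding maximal_partial_transversal_def by blast
    \<comment> \<open>\<open>T\<close> itself is injective in every coordinate, so a failure must
      come from \<open>e\<close> sharing a coordinate with an entry of \<open>T\<close>.\<close>
    then have "\<not> (inj_on ?p (insert e T) \<and> inj_on ?q (insert e T) \<and> inj_on ?s (insert e T))"
      using lines_at_most_once_iff[OF L, of "insert e T"] sub e by blast
    then show ?thesis using inj False by auto
  qed blast
qed auto

theorem theorem2p6: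
  fixes n d :: nat and S :: "'s set" and L :: "nat \<Rightarrow> nat \<Rightarrow> 's"
    and T :: "(nat \<times> nat \<times> 's) set"
  assumes "n \<ge> 3"
    and "latin_square n S L"
    and "maximal_partial_transversal n S L d T"
  shows
    "(d = 0 \<longrightarrow>
        card {C. is_c_cover n S L (n + 1) C \<and> T \<subseteq> C} = n ^ 2 - n \<and>
        (\<forall>C. is_c_cover n S L (n + 1) C \<and> T \<subseteq> C \<longrightarrow> \<not> minimal_cover n S L C)) \<and>
     (d = 1 \<longrightarrow>
        card {C. is_c_cover n S L (n + 1) C \<and> T \<subseteq> C} = 3 * (n - 1) \<and>
        (\<forall>C. is_c_cover n S L (n + 1) C \<and> T \<subseteq> C \<longrightarrow> minimal_cover n S L C)) \<and>
     (d = 2 \<longrightarrow>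
        card {C. is_c_cover n S L (n + 1) C \<and> T \<subseteq> C} = 8) \<and>
     (d \<ge> 3 \<longrightarrow>
        \<not> (\<exists>C. is_c_cover n S L (n + 1) C \<and> T \<subseteq> C))"
proof -
  interpret maximal_transversal "entries n L" fst "\<lambda>e. fst (snd e)" "\<lambda>e. snd (snd e)"
    "{..<n}" "{..<n}" S n d T
    using assms by (intro maximal_transversal_of_latin_square)
  \<comment> \<open>Lines are the fibres of the coordinates, so meeting all of them means that each
    coordinate is onto.\<close>
  have cover: "is_cover n S L C \<longleftrightarrow> cover C" for C
  proof (cases "C \<subseteq> entries n L")
    case True
    show ?thesis
      unfolding is_cover_def cover_def ball_latin_lines meets_fibres_iff_image[OF True] ..
  qed (simp add: is_cover_def cover_def)
  have eq: "{C. is_c_cover n S L (n + 1) C \<and> T \<subseteq> C} = {C. cover C \<and> card C = n + 1 \<and> T \<subseteq> C}"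
    unfolding is_c_cover_def cover by auto
  have completion: "\<exists>U. completion U \<and> C = T \<union> U"
    if "is_c_cover n S L (n + 1) C" "T \<subseteq> C" for C
  proof -
    have "C \<in> (\<union>) T ` Collect completion"
      using that unfolding covers_eq[symmetric] eq[symmetric] by simp
    then show ?thesis by blast
  qed
  show ?thesis
  proof (intro conjI impI allI)
    assume d: "d = 0"
    show "card {C. is_c_cover n S L (n + 1) C \<and> T \<subseteq> C} = n ^ 2 - n"
      unfolding eq card_covers using card_completion_deficit_0[OF d] .
    fix C assume "is_c_cover n S L (n + 1) C \<and> T \<subseteq> C"
    then show "\<not> minimal_cover n S L C"
      unfolding minimal_cover_def cover using completion deficit_0_not_minimal[OF d] by blast
  next
    assume d: "d = 1"
    show "card {C. is_c_cover n S L (n + 1) C \<and> T \<subseteq> C} = 3 * (n - 1)"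
      unfolding eq card_covers using card_completion_deficit_1[OF d] .
    fix C assume C: "is_c_cover n S L (n + 1) C \<and> T \<subseteq> C"
    then have "cover C" unfolding is_c_cover_def cover by blast
    then show "minimal_cover n S L C"
      unfolding minimal_cover_def cover using C completion deficit_1_minimal[OF d] by blast
  next
    assume d: "d = 2"
    show "card {C. is_c_cover n S L (n + 1) C \<and> T \<subseteq> C} = 8"
      unfolding eq card_covers using card_completion_deficit_2[OF d] .
  next
    assume "d \<ge> 3"
    then show "\<not> (\<exists>C. is_c_cover n S L (n + 1) C \<and> T \<subseteq> C)"
      using completion deficit_le_2 by fastforce
  qed
qed

end
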